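(* Let $R$ be a ring and let $M$ be a Euclidean $R$-module with Euclidean function $d_M$. Then: (1) Every submodule of $M$ is principal (i.e. generated by one element). In particular, $M$ is a cyclic Bezout module. (2) If $N$ is a nonzero submodule of $M$ then the set $\mathcal{G}(N)$ is non-empty and every element of $\mathcal{G}(N)$ generates $N$, i.e. the set of 1-generators $\{v\in N: N=Rv\}$ contains the non-empty set $\mathcal{G}(N)$.
   Context: Rings are unital and modules are left modules. A poset is Artinian if every descending chain in it stabilizes. An $R$-module $M$ is a Euclidean module if there is a function $d_M:M\setminus\{0\}\to P$ to a poset $(P,\ge)$ such that the poset $\mathrm{im}(d_M)$ is Artinian and, for any nonzero $u,v\in M$, there are $q\in R$ and $r\in M$ with $u=qv+r$ and either $r=0$ or $d_M(r)<d_M(v)$. For a nonzero submodule $N\subseteq M$: $g(N):=\min\{d_M(x):0\neq x\in N\}$ (the least value; it is presupposed to exist) and $\mathcal{G}(N):=\{x\in N: x\neq 0,\ d_M(x)=g(N)\}$. A module is a Bezout module if every finitely generated submodule is principal. *)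

theory Defs
  imports "HOL-Algebra.Algebra"
begin

(* The library locale module requires a commutative base ring; this is the same
   axiomatisation over an arbitrary unital ring. *)
locale left_module = R?: ring R + M?: abelian_group M
  for R :: "('r, 'x) ring_scheme" (structure) and M :: "('r, 'm, 'y) module_scheme" (structure) +
  assumes smult_closed [simp, intro]:
      "\<lbrakk>a \<in> carrier R; x \<in> carrier M\<rbrakk> \<Longrightarrow> a \<odot>\<^bsub>M\<^esub> x \<in> carrier M"
    and smult_l_distr:
      "\<lbrakk>a \<in> carrier R; b \<in> carrier R; x \<in> carrier M\<rbrakk> \<Longrightarrow>
        (a \<oplus> b) \<odot>\<^bsub>M\<^esub> x = a \<odot>\<^bsub>M\<^esub> x \<oplus>\<^bsub>M\<^esub> b \<odot>\<^bsub>M\<^esub> x"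
    and smult_r_distr:
      "\<lbrakk>a \<in> carrier R; x \<in> carrier M; y \<in> carrier M\<rbrakk> \<Longrightarrow>
        a \<odot>\<^bsub>M\<^esub> (x \<oplus>\<^bsub>M\<^esub> y) = a \<odot>\<^bsub>M\<^esub> x \<oplus>\<^bsub>M\<^esub> a \<odot>\<^bsub>M\<^esub> y"
    and smult_assoc1:
      "\<lbrakk>a \<in> carrier R; b \<in> carrier R; x \<in> carrier M\<rbrakk> \<Longrightarrow>
        (a \<otimes> b) \<odot>\<^bsub>M\<^esub> x = a \<odot>\<^bsub>M\<^esub> (b \<odot>\<^bsub>M\<^esub> x)"
    and smult_one [simp]:
      "x \<in> carrier M \<Longrightarrow> \<one> \<odot>\<^bsub>M\<^esub> x = x"

definition multiples :: "('r, 'x) ring_scheme \<Rightarrow> ('r, 'm, 'y) module_scheme \<Rightarrow> 'm \<Rightarrow> 'm set"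
  where "multiples R M v = {r \<odot>\<^bsub>M\<^esub> v | r. r \<in> carrier R}"

definition submodule_generated ::
    "('r, 'x) ring_scheme \<Rightarrow> ('r, 'm, 'y) module_scheme \<Rightarrow> 'm set \<Rightarrow> 'm set"
  where "submodule_generated R M S = \<Inter>{N. submodule N R M \<and> S \<subseteq> N}"

lemma (in left_module) submodule_multiples:
  assumes v: "v \<in> carrier M"
  shows "submodule (multiples R M v) R M"
proof -
  have zero: "\<zero> \<odot>\<^bsub>M\<^esub> v = \<zero>\<^bsub>M\<^esub>"
  proof -
    have "\<zero> \<odot>\<^bsub>M\<^esub> v \<oplus>\<^bsub>M\<^esub> \<zero> \<odot>\<^bsub>M\<^esub> v = \<zero> \<odot>\<^bsub>M\<^esub> v"
      using smult_l_distr[of \<zero> \<zero> v] v by simp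
    then show ?thesis
      using v by (metis M.add.r_cancel_one' R.zero_closed smult_closed)
  qed
  have neg: "\<ominus>\<^bsub>M\<^esub> (r \<odot>\<^bsub>M\<^esub> v) = (\<ominus> r) \<odot>\<^bsub>M\<^esub> v" if r: "r \<in> carrier R" for r
  proof -
    have "(\<ominus> r) \<odot>\<^bsub>M\<^esub> v \<oplus>\<^bsub>M\<^esub> r \<odot>\<^bsub>M\<^esub> v = \<zero>\<^bsub>M\<^esub>"
      using smult_l_distr[of "\<ominus> r" r v] v r zero by (simp add: R.l_neg)
    then show ?thesis
      using v r M.minus_equality by simp
  qed
  have "\<exists>s. r \<odot>\<^bsub>M\<^esub> v \<oplus>\<^bsub>M\<^esub> t \<odot>\<^bsub>M\<^esub> v = s \<odot>\<^bsub>M\<^esub> v \<and> s \<in> carrier R"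
    if "r \<in> carrier R" "t \<in> carrier R" for r t
    using smult_l_distr[of r t v] v that by (metis R.add.m_closed)
  moreover have "\<exists>s. \<zero>\<^bsub>M\<^esub> = s \<odot>\<^bsub>M\<^esub> v \<and> s \<in> carrier R"
    using zero by (metis R.zero_closed)
  moreover have "\<exists>s. \<ominus>\<^bsub>M\<^esub> (r \<odot>\<^bsub>M\<^esub> v) = s \<odot>\<^bsub>M\<^esub> v \<and> s \<in> carrier R"
    if "r \<in> carrier R" for r
    using neg that by (metis R.a_inv_closed)
  moreover have "\<exists>s. a \<odot>\<^bsub>M\<^esub> (r \<odot>\<^bsub>M\<^esub> v) = s \<odot>\<^bsub>M\<^esub> v \<and> s \<in> carrier R"
    if "a \<in> carrier R" "r \<in> carrier R" for a r
    using smult_assoc1[of a r v] v that by (metis R.m_closed)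
  ultimately show ?thesis
    unfolding multiples_def using v
    by (intro submodule.intro subgroup.intro submodule_axioms.intro)
       (auto simp flip: a_inv_def)
qed

lemma (in left_module) multiples_eq_submodule_generated:
  assumes v: "v \<in> carrier M"
  shows "multiples R M v = submodule_generated R M {v}"
proof
  show "multiples R M v \<subseteq> submodule_generated R M {v}"
    unfolding multiples_def submodule_generated_def
    by (auto intro: submodule.smult_closed)
  have "v \<in> multiples R M v"
    unfolding multiples_def using smult_one[OF v] R.one_closed by force
  then show "submodule_generated R M {v} \<subseteq> multiples R M v"
    unfolding submodule_generated_def using submodule_multiples[OF v] by auto
qed

definition principal_submodule ::
    "('r, 'x) ring_scheme \<Rightarrow> ('r, 'm, 'y) module_scheme \<Rightarrow> 'm set \<Rightarrow> bool"
  where "principal_submodule R M N \<longleftrightarrow> (\<exists>v \<in> carrier M. N = multiples R M v)"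

definition finitely_generated_submodule ::
    "('r, 'x) ring_scheme \<Rightarrow> ('r, 'm, 'y) module_scheme \<Rightarrow> 'm set \<Rightarrow> bool"
  where "finitely_generated_submodule R M N \<longleftrightarrow>
    (\<exists>S. finite S \<and> S \<subseteq> carrier M \<and> N = submodule_generated R M S)"

definition cyclic_module :: "('r, 'x) ring_scheme \<Rightarrow> ('r, 'm, 'y) module_scheme \<Rightarrow> bool"
  where "cyclic_module R M \<longleftrightarrow> principal_submodule R M (carrier M)"

definition bezout_module :: "('r, 'x) ring_scheme \<Rightarrow> ('r, 'm, 'y) module_scheme \<Rightarrow> bool"
  where "bezout_module R M \<longleftrightarrow>
    (\<forall>N. submodule N R M \<and> finitely_generated_submodule R M N \<longrightarrow> principal_submodule R M N)"

definition artinian_poset :: "'p::order set \<Rightarrow> bool"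
  where "artinian_poset A \<longleftrightarrow>
    (\<forall>f :: nat \<Rightarrow> 'p. range f \<subseteq> A \<and> antimono f \<longrightarrow> (\<exists>n. \<forall>m\<ge>n. f m = f n))"

(* Only the values of d on nonzero elements of the carrier matter. *)
locale euclidean_module = left_module R M
  for R :: "('r, 'x) ring_scheme" (structure) and M :: "('r, 'm, 'y) module_scheme" (structure) +
  fixes d :: "'m \<Rightarrow> 'p::order"
  assumes artinian: "artinian_poset (d ` (carrier M - {\<zero>\<^bsub>M\<^esub>}))"
    and division:
      "\<lbrakk>u \<in> carrier M - {\<zero>\<^bsub>M\<^esub>}; v \<in> carrier M - {\<zero>\<^bsub>M\<^esub>}\<rbrakk> \<Longrightarrow>
        \<exists>q \<in> carrier R. \<exists>r \<in> carrier M.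
          u = q \<odot>\<^bsub>M\<^esub> v \<oplus>\<^bsub>M\<^esub> r \<and> (r = \<zero>\<^bsub>M\<^esub> \<or> d r < d v)"

(* The values of d are only partially ordered, so the set of values on N need not have a
   least element; min_value M d N is meaningful only if has_min_value M d N. *)
definition has_min_value :: "('r, 'm, 'y) module_scheme \<Rightarrow> ('m \<Rightarrow> 'p::order) \<Rightarrow> 'm set \<Rightarrow> bool"
  where "has_min_value M d N \<longleftrightarrow>
    (\<exists>x \<in> N - {\<zero>\<^bsub>M\<^esub>}. \<forall>y \<in> N - {\<zero>\<^bsub>M\<^esub>}. d x \<le> d y)"

definition min_value :: "('r, 'm, 'y) module_scheme \<Rightarrow> ('m \<Rightarrow> 'p::order) \<Rightarrow> 'm set \<Rightarrow> 'p"
  where "min_value M d N = (LEAST p. p \<in> d ` (N - {\<zero>\<^bsub>M\<^esub>}))"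

definition min_elements :: "('r, 'm, 'y) module_scheme \<Rightarrow> ('m \<Rightarrow> 'p::order) \<Rightarrow> 'm set \<Rightarrow> 'm set"
  where "min_elements M d N = {x \<in> N. x \<noteq> \<zero>\<^bsub>M\<^esub> \<and> d x = min_value M d N}"

end

theory Submission
  imports Defs
begin

text \<open>
  An element \<open>v\<close> of a nonzero submodule \<open>N\<close> at which \<open>d\<close> is minimal generates \<open>N\<close>: dividing
  \<open>u \<in> N\<close> by \<open>v\<close> leaves a remainder in \<open>N\<close>, which must be zero. Such a \<open>v\<close> exists by the
  descending chain condition. Minimal, rather than least, is all that the argument needs.
\<close>

text \<open>If every element of \<open>B\<close> had a strictly smaller one in \<open>B\<close>,
  dependent choice would build a strictly descending sequence in \<open>A\<close>, which cannot
  stabilize. In a partial order this yields minimal elements, not least ones.\<close>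

lemma artinian_poset_minimal:
  assumes art: "artinian_poset A" and B: "B \<subseteq> A" "B \<noteq> {}"
  obtains p where "p \<in> B" "\<And>q. q \<in> B \<Longrightarrow> \<not> q < p"
proof (rule ccontr)
  assume "\<not> thesis"
  then have step: "\<exists>q. q \<in> B \<and> q < p" if "p \<in> B" for p
    using that \<open>\<And>p. \<lbrakk>p \<in> B; \<And>q. q \<in> B \<Longrightarrow> \<not> q < p\<rbrakk> \<Longrightarrow> thesis\<close> by blast
  obtain f :: "nat \<Rightarrow> _" where f: "\<And>n. f n \<in> B" "\<And>n. f (Suc n) < f n"
    using dependent_nat_choice[of "\<lambda>_ p. p \<in> B" "\<lambda>_ p q. q < p"] B step by blast
  have "range f \<subseteq> A"
    using f(1) B(1) by blast
  moreover have "antimono f"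
    using f(2) by (intro decseq_SucI less_imp_le)
  ultimately obtain n where "\<forall>m\<ge>n. f m = f n"
    using art[unfolded artinian_poset_def, rule_format, of f] by auto
  then have "f (Suc n) = f n"
    using le_SucI[OF order_refl] by blast
  then show False
    using f(2)[of n] by (metis less_irrefl)
qed

text \<open>Serves the zero submodule, which has no nonzero element at which \<open>d\<close> could
  be minimal.\<close>

lemma (in left_module) multiples_zero: "multiples R M \<zero>\<^bsub>M\<^esub> = {\<zero>\<^bsub>M\<^esub>}"
proof -
  have "a \<odot>\<^bsub>M\<^esub> \<zero>\<^bsub>M\<^esub> = \<zero>\<^bsub>M\<^esub>" if a: "a \<in> carrier R" for a
  proof -
    have "a \<odot>\<^bsub>M\<^esub> \<zero>\<^bsub>M\<^esub> \<oplus>\<^bsub>M\<^esub> a \<odot>\<^bsub>M\<^esub> \<zero>\<^bsub>M\<^esub> = a \<odot>\<^bsub>M\<^esub> \<zero>\<^bsub>M\<^esub>"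
      using smult_r_distr[OF a, of "\<zero>\<^bsub>M\<^esub>" "\<zero>\<^bsub>M\<^esub>"] by simp
    then show ?thesis
      using a by (metis M.add.r_cancel_one' M.zero_closed smult_closed)
  qed
  then show ?thesis
    unfolding multiples_def by (auto intro!: exI[of _ \<one>])
qed

lemma (in left_module) submodule_carrier: "submodule (carrier M) R M"
  by (intro submodule.intro subgroup.intro submodule_axioms.intro)
     (auto simp flip: a_inv_def)

context euclidean_module
begin

lemma minimal_element_generates:
  assumes N: "submodule N R M"
    and v: "v \<in> N" "v \<noteq> \<zero>\<^bsub>M\<^esub>"
    and min: "\<And>y. \<lbrakk>y \<in> N; y \<noteq> \<zero>\<^bsub>M\<^esub>\<rbrakk> \<Longrightarrow> \<not> d y < d v"
  shows "N = multiples R M v"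
proof
  interpret N: submodule N R M by (fact N)
  have sub: "N \<subseteq> carrier M"
    using N.subset by simp
  show "multiples R M v \<subseteq> N"
    unfolding multiples_def using v by (auto intro: N.smult_closed)
  show "N \<subseteq> multiples R M v"
  proof
    fix u assume u: "u \<in> N"
    show "u \<in> multiples R M v"
    proof (cases "u = \<zero>\<^bsub>M\<^esub>")
      case True
      \<comment> \<open>\<open>division\<close> only covers a nonzero dividend. Here
        \<open>subgroup.one_closed\<close> concerns the additive group, whose unit is zero.\<close>
      then show ?thesis
        using subgroup.one_closed[OF submodule.axioms(1)[OF submodule_multiples, of v]] v sub
        by auto
    next
      case False
      then obtain q r where q: "q \<in> carrier R" and r: "r \<in> carrier M"
        and eq: "u = q \<odot>\<^bsub>M\<^esub> v \<oplus>\<^bsub>M\<^esub> r" and small: "r = \<zero>\<^bsub>M\<^esub> \<or> d r < d v"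
        using division[of u v] u v sub by blast
      have qv: "q \<odot>\<^bsub>M\<^esub> v \<in> N"
        using q v(1) by (rule N.smult_closed)
      then have "\<ominus>\<^bsub>M\<^esub> (q \<odot>\<^bsub>M\<^esub> v) \<oplus>\<^bsub>M\<^esub> u \<in> N"
        using u N.m_inv_closed[of "q \<odot>\<^bsub>M\<^esub> v"] N.m_closed by (simp add: a_inv_def)
      moreover have "\<ominus>\<^bsub>M\<^esub> (q \<odot>\<^bsub>M\<^esub> v) \<oplus>\<^bsub>M\<^esub> u = r"
        using M.r_neg1[of "q \<odot>\<^bsub>M\<^esub> v" r] qv r sub eq by (metis subsetD)
      \<comment> \<open>A nonzero \<open>r\<close> would be an element of \<open>N\<close> with
        \<open>d r < d v\<close>, against the minimality of \<open>v\<close>.\<close>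
      ultimately have "r = \<zero>\<^bsub>M\<^esub>"
        using small min by metis
      then have "u = q \<odot>\<^bsub>M\<^esub> v"
        using eq qv sub by (metis M.r_zero subsetD)
      then show ?thesis
        using q unfolding multiples_def by blast
    qed
  qed
qed

lemma submodule_principal:
  assumes N: "submodule N R M"
  shows "principal_submodule R M N"
proof (cases "N = {\<zero>\<^bsub>M\<^esub>}")
  case True
  then show ?thesis
    unfolding principal_submodule_def using multiples_zero by blast
next
  case False
  interpret N: submodule N R M by (fact N)
  have sub: "N \<subseteq> carrier M" and "\<zero>\<^bsub>M\<^esub> \<in> N"
    using N.subset N.one_closed by simp_all
  then have "d ` (N - {\<zero>\<^bsub>M\<^esub>}) \<noteq> {}" "d ` (N - {\<zero>\<^bsub>M\<^esub>}) \<subseteq> d ` (carrier M - {\<zero>\<^bsub>M\<^esub>})"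
    using False by auto
  \<comment> \<open>The chain condition concerns values of \<open>d\<close>, so a minimal value is
    found first and then lifted to an element \<open>v\<close> attaining it.\<close>
  then obtain p where "p \<in> d ` (N - {\<zero>\<^bsub>M\<^esub>})" "\<And>q. q \<in> d ` (N - {\<zero>\<^bsub>M\<^esub>}) \<Longrightarrow> \<not> q < p"
    using artinian_poset_minimal[OF artinian] by metis
  then obtain v where "v \<in> N" "v \<noteq> \<zero>\<^bsub>M\<^esub>" "\<And>y. \<lbrakk>y \<in> N; y \<noteq> \<zero>\<^bsub>M\<^esub>\<rbrakk> \<Longrightarrow> \<not> d y < d v"
    by blast
  then show ?thesis
    unfolding principal_submodule_def using minimal_element_generates[OF N] sub by blast
qed

end

text \<open>Once a least value is attained, \<open>LEAST\<close> denotes it, and by antisymmetry any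
  other element lying below all values has that same value. This removes \<open>LEAST\<close> from
  later arguments.\<close>

lemma min_elements_eq:
  assumes "has_min_value M d N"
  shows "min_elements M d N = {x \<in> N - {\<zero>\<^bsub>M\<^esub>}. \<forall>y \<in> N - {\<zero>\<^bsub>M\<^esub>}. d x \<le> d y}"
proof -
  obtain x where x: "x \<in> N - {\<zero>\<^bsub>M\<^esub>}" and le: "\<forall>y \<in> N - {\<zero>\<^bsub>M\<^esub>}. d x \<le> d y"
    using assms unfolding has_min_value_def by blast
  have "min_value M d N = d x"
    unfolding min_value_def using x le by (intro Least_equality) auto
  then show ?thesis
    unfolding min_elements_def using x le by (auto intro: order.antisym)
qed

theorem proposition2p4:
  fixes R :: "('r, 'x) ring_scheme"
    and M :: "('r, 'm, 'y) module_scheme"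
    and d :: "'m \<Rightarrow> 'p::order"
  assumes "euclidean_module R M d"
  shows "(\<forall>N. submodule N R M \<longrightarrow> principal_submodule R M N)
      \<and> cyclic_module R M \<and> bezout_module R M
      \<and> (\<forall>N. submodule N R M \<and> N \<noteq> {\<zero>\<^bsub>M\<^esub>} \<and> has_min_value M d N \<longrightarrow>
            min_elements M d N \<noteq> {} \<and>
            min_elements M d N \<subseteq> {v \<in> N. N = multiples R M v})"
proof -
  interpret euclidean_module R M d by (fact assms)
  have "min_elements M d N \<noteq> {} \<and> min_elements M d N \<subseteq> {v \<in> N. N = multiples R M v}"
    if N: "submodule N R M" and has_min: "has_min_value M d N" for N
  proof
    show "min_elements M d N \<noteq> {}"
      using has_min unfolding min_elements_eq[OF has_min] has_min_value_def by blast
    show "min_elements M d N \<subseteq> {v \<in> N. N = multiples R M v}"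
    proof
      fix v assume "v \<in> min_elements M d N"
      then have v: "v \<in> N" "v \<noteq> \<zero>\<^bsub>M\<^esub>" and least: "\<forall>y \<in> N - {\<zero>\<^bsub>M\<^esub>}. d v \<le> d y"
        unfolding min_elements_eq[OF has_min] by auto
      have "N = multiples R M v"
        \<comment> \<open>A least value is in particular minimal: \<open>leD\<close> turns
          \<open>d v \<le> d y\<close> into \<open>\<not> d y < d v\<close>.\<close>
        using least by (intro minimal_element_generates[OF N v]) (auto dest: leD)
      with v show "v \<in> {v \<in> N. N = multiples R M v}"
        by blast
    qed
  qed
  \<comment> \<open>Cyclicity is principality of the submodule \<open>carrier M\<close>; the Bezout
    property restricts principality to finitely generated submodules.\<close>
  then show ?thesis
    unfolding cyclic_module_def bezout_module_def
    using submodule_principal submodule_carrier by blast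
qed

end
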